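(* Let $(G,w)$ be a finite, connected network and let $(X_n)_{n\ge0}$ be the network random walk on $(G,w)$ with an arbitrary initial distribution. Let $\tau_{\mathrm{cov}}:=\min\{n\ge 0:\{X_0,\dots,X_n\}=V\}$ be the cover time. Then for all $n\in\mathbb N$: (i) $F\bigl((X_0,\ldots,X_n)\bigr)$ and $L\bigl((X_0,\ldots,X_n)\bigr)$ have the same distribution; and (ii) $F\bigl((X_0,\ldots,X_{\tau_{\mathrm{cov}}\wedge n})\bigr)$ and $L\bigl((X_0,\ldots,X_{\tau_{\mathrm{cov}}\wedge n})\bigr)$ have the same distribution.
   Context: A finite connected network $(G,w)$ is a finite connected simple graph $G=(V,E)$ with weights $w\colon E\to(0,\infty)$. Write $w(x)$ for the sum of $w(e)$ over all edges $e$ incident to $x$, and $x\sim y$ if $\{x,y\}\in E$. The network random walk is the Markov chain on $V$ with transition probabilities $p(x,y)=\frac{w(x,y)}{w(x)}\mathbf 1_{\{x\sim y\}}$. A path of length $n$ is a sequence $\gamma=(v_0,\dots,v_n)$ of vertices with $v_{i-1}\sim v_i$ for $1\le i\le n$; let $V(\gamma)=\{v_0,\dots,v_n\}$. First-entrance operator $F$: for $u\in V(\gamma)\setminus\{v_0\}$, let $i\ge1$ be the smallest index with $v_i=u$; the first-entrance edge to $u$ is $\{v_{i-1},v_i\}$. $F(\gamma)$ is the subtree of $G$ (with vertex set $V(\gamma)$) formed by the first-entrance edges to all vertices of $V(\gamma)\setminus\{v_0\}$. Last-exit operator $L$: for $u\in V(\gamma)\setminus\{v_n\}$, let $i\le n-1$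 be the largest index with $v_i=u$; the last-exit edge of $u$ is $\{v_i,v_{i+1}\}$. $L(\gamma)$ is the subtree of $G$ (with vertex set $V(\gamma)$) formed by the last-exit edges of all vertices of $V(\gamma)\setminus\{v_n\}$. Both $F(\gamma)$ and $L(\gamma)$ are regarded as unoriented, unrooted subtrees of $G$. *)

theory Defs
  imports "HOL-Probability.Probability" "HOL-Library.Extended_Nat"
begin

text \<open>A simple graph is given by a vertex set and a set of two-element vertex sets. The weight
  function is total; its values outside the edge set are irrelevant.\<close>

locale finite_connected_network =
  fixes V :: "'v set" and E :: "'v set set" and w :: "'v set \<Rightarrow> real"
  assumes finite_V: "finite V"
    and V_nonempty: "V \<noteq> {}"
    and edges: "\<And>e. e \<in> E \<Longrightarrow> e \<subseteq> V \<and> card e = 2"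
    and connected: "\<And>x y. x \<in> V \<Longrightarrow> y \<in> V \<Longrightarrow> (x, y) \<in> {(a, b). {a, b} \<in> E}\<^sup>*"
    and weight_pos: "\<And>e. e \<in> E \<Longrightarrow> 0 < w e"

definition vertex_weight :: "'v set set \<Rightarrow> ('v set \<Rightarrow> real) \<Rightarrow> 'v \<Rightarrow> real" where
  "vertex_weight E w x = (\<Sum>e\<in>{e \<in> E. x \<in> e}. w e)"

definition transition_prob :: "'v set set \<Rightarrow> ('v set \<Rightarrow> real) \<Rightarrow> 'v \<Rightarrow> 'v \<Rightarrow> real" where
  "transition_prob E w x y = (if {x, y} \<in> E then w {x, y} / vertex_weight E w x else 0)"

text \<open>The initial distribution, i.e. the law of \<open>X 0\<close>, is unconstrained. For a one-vertex network
  all transition probabilities vanish, so no such chain exists.\<close>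

locale network_random_walk = finite_connected_network V E w + prob_space M
  for V :: "'v set" and E :: "'v set set" and w :: "'v set \<Rightarrow> real" and M :: "'m measure" +
  fixes X :: "nat \<Rightarrow> 'm \<Rightarrow> 'v"
  assumes random_variable_X: "\<And>n. X n \<in> M \<rightarrow>\<^sub>M count_space V"
    and markov: "\<And>n v y. y \<in> V \<Longrightarrow> (\<And>i. i \<le> n \<Longrightarrow> v i \<in> V) \<Longrightarrow>
      \<P>(\<omega> in M. \<forall>i\<le>n. X i \<omega> = v i) > 0 \<Longrightarrow>
      \<P>(\<omega> in M. X (Suc n) \<omega> = y \<bar> \<forall>i\<le>n. X i \<omega> = v i) = transition_prob E w (v n) y"

text \<open>The path \<open>(v\<^sub>0, \<dots>, v\<^sub>n)\<close> is the list of its \<open>n + 1\<close> vertices. An unoriented, unrooted subtree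
  is the pair of its vertex set and its edge set. Both operators are total on lists; they are
  meaningful on nonempty lists whose consecutive entries are adjacent, which a random walk
  produces almost surely.\<close>

definition first_entrance_edge :: "'v list \<Rightarrow> 'v \<Rightarrow> 'v set" where
  "first_entrance_edge \<gamma> u =
    (let i = (LEAST i. 1 \<le> i \<and> i < length \<gamma> \<and> \<gamma> ! i = u) in {\<gamma> ! (i - 1), \<gamma> ! i})"

definition first_entrance_tree :: "'v list \<Rightarrow> 'v set \<times> 'v set set" where
  "first_entrance_tree \<gamma> = (set \<gamma>, first_entrance_edge \<gamma> ` (set \<gamma> - {hd \<gamma>}))"

definition last_exit_edge :: "'v list \<Rightarrow> 'v \<Rightarrow> 'v set" where
  "last_exit_edge \<gamma> u =
    (let i = (GREATEST i. i + 1 < length \<gamma> \<and> \<gamma> ! i = u) in {\<gamma> ! i, \<gamma> ! (i + 1)})"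

definition last_exit_tree :: "'v list \<Rightarrow> 'v set \<times> 'v set set" where
  "last_exit_tree \<gamma> = (set \<gamma>, last_exit_edge \<gamma> ` (set \<gamma> - {last \<gamma>}))"

definition path_upto :: "(nat \<Rightarrow> 'm \<Rightarrow> 'v) \<Rightarrow> nat \<Rightarrow> 'm \<Rightarrow> 'v list" where
  "path_upto X n \<omega> = map (\<lambda>i. X i \<omega>) [0..<Suc n]"

text \<open>The infimum of the empty set is \<open>\<infinity>\<close>, the value when \<open>V\<close> is never covered.\<close>

definition cover_time :: "'v set \<Rightarrow> (nat \<Rightarrow> 'm \<Rightarrow> 'v) \<Rightarrow> 'm \<Rightarrow> enat" where
  "cover_time V X \<omega> = Inf (enat ` {n. (\<lambda>i. X i \<omega>) ` {..n} = V})"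

definition path_upto_cover :: "'v set \<Rightarrow> (nat \<Rightarrow> 'm \<Rightarrow> 'v) \<Rightarrow> nat \<Rightarrow> 'm \<Rightarrow> 'v list" where
  "path_upto_cover V X n \<omega> = path_upto X (the_enat (min (cover_time V X \<omega>) (enat n))) \<omega>"

end

theory Submission
  imports Defs
begin

text \<open>The first-entrance tree of a path is the last-exit tree of its reversal. Up to a factor
  depending only on its endpoints, the probability of a path is a product of a symmetric kernel over
  its steps, and this product is invariant under reversal. So it suffices that the
  total weight of the paths from \<open>x\<close> to \<open>y\<close> with a given multiset of vertices and a given last-exit tree is symmetric in \<open>x\<close> and
  \<open>y\<close>, which follows by induction on the length. Fixing the multiset of vertices, and not only the
  length, also covers the walk stopped at the cover time.\<close>

section \<open>Both trees when a path grows by one vertex\<close>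

lemma last_exit_edge_Cons:
  assumes "u \<in> set \<gamma>" "u \<noteq> last \<gamma>"
  shows "last_exit_edge (x # \<gamma>) u = last_exit_edge \<gamma> u"
proof -
  let ?P = "\<lambda>i. i + 1 < length \<gamma> \<and> \<gamma> ! i = u"
  let ?G = "GREATEST i. ?P i"
  obtain i where i: "i < length \<gamma>" "\<gamma> ! i = u"
    using assms(1) by (auto simp: in_set_conv_nth)
  \<comment> \<open>As \<open>u\<close> is not the last vertex, each of its occurrences has a
    successor in \<open>\<gamma>\<close>; so the greatest index is attained, and prepending
    \<open>x\<close> shifts it by one.\<close>
  have "i \<noteq> length \<gamma> - 1"
    using i assms by (metis last_conv_nth list.size(3) less_nat_zero_code)
  with i have Pi: "?P i" by auto
  have bound: "\<And>y. ?P y \<Longrightarrow> y \<le> length \<gamma>" by auto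
  have G: "?P ?G" by (rule GreatestI_nat[of ?P, OF Pi bound])
  have le: "j \<le> ?G" if "?P j" for j by (rule Greatest_le_nat[of ?P, OF that bound])
  have "(GREATEST i. i + 1 < length (x # \<gamma>) \<and> (x # \<gamma>) ! i = u) = Suc ?G"
  proof (rule Greatest_equality)
    show "Suc ?G + 1 < length (x # \<gamma>) \<and> (x # \<gamma>) ! Suc ?G = u" using G by simp
    show "j \<le> Suc ?G" if "j + 1 < length (x # \<gamma>) \<and> (x # \<gamma>) ! j = u" for j
      using that le[of "j - 1"] by (cases j) auto
  qed
  then show ?thesis by (simp add: last_exit_edge_def Let_def)
qed

lemma last_exit_edge_hd:
  assumes "x \<notin> set \<gamma>" "\<gamma> \<noteq> []"
  shows "last_exit_edge (x # \<gamma>) x = {x, hd \<gamma>}"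
proof -
  have "(GREATEST i. i + 1 < length (x # \<gamma>) \<and> (x # \<gamma>) ! i = x) = 0"
  proof (rule Greatest_equality)
    show "0 + 1 < length (x # \<gamma>) \<and> (x # \<gamma>) ! 0 = x" using assms by simp
    show "j \<le> 0" if "j + 1 < length (x # \<gamma>) \<and> (x # \<gamma>) ! j = x" for j
      using that assms by (cases j) auto
  qed
  then show ?thesis using assms by (simp add: last_exit_edge_def Let_def hd_conv_nth)
qed

lemma last_exit_tree_singleton [simp]: "last_exit_tree [x] = ({x}, {})"
  by (simp add: last_exit_tree_def)

text \<open>Last exits look only at the end of a path. A prepended vertex that recurs later has its
  last exit later, so nothing changes; a fresh one becomes a leaf hung on the old head.\<close>

lemma last_exit_tree_Cons:
  assumes "\<gamma> \<noteq> []"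
  shows "last_exit_tree (x # \<gamma>) = (if x \<in> set \<gamma> then last_exit_tree \<gamma>
    else (insert x (set \<gamma>), insert {x, hd \<gamma>} (snd (last_exit_tree \<gamma>))))"
proof (cases "x \<in> set \<gamma>")
  case True
  have "last_exit_edge (x # \<gamma>) ` (set \<gamma> - {last \<gamma>}) = last_exit_edge \<gamma> ` (set \<gamma> - {last \<gamma>})"
    by (rule image_cong) (auto simp: last_exit_edge_Cons)
  then show ?thesis using True assms by (simp add: last_exit_tree_def insert_absorb)
next
  case False
  have "last_exit_edge (x # \<gamma>) ` (set \<gamma> - {last \<gamma>}) = last_exit_edge \<gamma> ` (set \<gamma> - {last \<gamma>})"
    by (rule image_cong) (auto simp: last_exit_edge_Cons)
  moreover have "set (x # \<gamma>) - {last (x # \<gamma>)} = insert x (set \<gamma> - {last \<gamma>})"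
    using False assms by auto
  ultimately show ?thesis using False assms
    by (simp add: last_exit_tree_def last_exit_edge_hd)
qed

text \<open>This guarantees that the edge to a freshly prepended leaf is new, so that deleting it
  from the tree recovers the tree of the tail.\<close>

lemma last_exit_tree_edges_subset:
  "\<gamma> \<noteq> [] \<Longrightarrow> e \<in> snd (last_exit_tree \<gamma>) \<Longrightarrow> e \<subseteq> set \<gamma>"
proof (induction \<gamma>)
  case (Cons x \<gamma>)
  then show ?case
    by (cases "\<gamma> = []") (auto simp: last_exit_tree_Cons split: if_splits)
qed simp

lemma first_entrance_edge_snoc:
  assumes "u \<in> set \<gamma>" "u \<noteq> hd \<gamma>"
  shows "first_entrance_edge (\<gamma> @ [x]) u = first_entrance_edge \<gamma> u"
proof -
  let ?P = "\<lambda>i. 1 \<le> i \<and> i < length \<gamma> \<and> \<gamma> ! i = u"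
  let ?m = "LEAST i. ?P i"
  obtain i where i: "i < length \<gamma>" "\<gamma> ! i = u"
    using assms(1) by (auto simp: in_set_conv_nth)
  have "i \<noteq> 0" using i assms by (metis hd_conv_nth length_greater_0_conv)
  with i have Pi: "?P i" by auto
  have m: "?P ?m" by (rule LeastI[of ?P, OF Pi])
  have le: "?m \<le> j" if "?P j" for j by (rule Least_le[of ?P, OF that])
  have "(LEAST i. 1 \<le> i \<and> i < length (\<gamma> @ [x]) \<and> (\<gamma> @ [x]) ! i = u) = ?m"
  proof (rule Least_equality)
    show "1 \<le> ?m \<and> ?m < length (\<gamma> @ [x]) \<and> (\<gamma> @ [x]) ! ?m = u"
      using m by (simp add: nth_append)
    show "?m \<le> j" if "1 \<le> j \<and> j < length (\<gamma> @ [x]) \<and> (\<gamma> @ [x]) ! j = u" for j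
      using that le[of j] m by (cases "j < length \<gamma>") (auto simp: nth_append)
  qed
  moreover have "?m - 1 < length \<gamma>" using m by auto
  ultimately show ?thesis using m
    by (simp add: first_entrance_edge_def Let_def nth_append)
qed

lemma first_entrance_edge_last:
  assumes "x \<notin> set \<gamma>" "\<gamma> \<noteq> []"
  shows "first_entrance_edge (\<gamma> @ [x]) x = {last \<gamma>, x}"
proof -
  have "(LEAST i. 1 \<le> i \<and> i < length (\<gamma> @ [x]) \<and> (\<gamma> @ [x]) ! i = x) = length \<gamma>"
  proof (rule Least_equality)
    show "1 \<le> length \<gamma> \<and> length \<gamma> < length (\<gamma> @ [x]) \<and> (\<gamma> @ [x]) ! length \<gamma> = x"
      using assms by (simp add: Suc_le_eq)
    show "length \<gamma> \<le> j" if "1 \<le> j \<and> j < length (\<gamma> @ [x]) \<and> (\<gamma> @ [x]) ! j = x" for j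
      using that assms by (cases "j < length \<gamma>") (auto simp: nth_append)
  qed
  then show ?thesis using assms
    by (simp add: first_entrance_edge_def Let_def nth_append last_conv_nth)
qed

text \<open>Mirror image of the recursion for last exits: an appended vertex contributes a leaf edge
  exactly when it is visited for the first time.\<close>

lemma first_entrance_tree_snoc:
  assumes "\<gamma> \<noteq> []"
  shows "first_entrance_tree (\<gamma> @ [x]) = (if x \<in> set \<gamma> then first_entrance_tree \<gamma>
    else (insert x (set \<gamma>), insert {x, last \<gamma>} (snd (first_entrance_tree \<gamma>))))"
proof -
  have im: "first_entrance_edge (\<gamma> @ [x]) ` (set \<gamma> - {hd \<gamma>}) = first_entrance_edge \<gamma> ` (set \<gamma> - {hd \<gamma>})"
    by (rule image_cong) (auto simp: first_entrance_edge_snoc)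
  show ?thesis
  proof (cases "x \<in> set \<gamma>")
    case True
    then show ?thesis using im assms by (simp add: first_entrance_tree_def insert_absorb)
  next
    case False
    have "set (\<gamma> @ [x]) - {hd (\<gamma> @ [x])} = insert x (set \<gamma> - {hd \<gamma>})"
      using False assms by auto
    then show ?thesis using False assms im
      by (simp add: first_entrance_tree_def first_entrance_edge_last insert_commute)
  qed
qed

text \<open>Reversal turns appending into prepending and \<open>last\<close> into \<open>hd\<close>,
  so the two recursions coincide.\<close>

lemma first_entrance_tree_eq_last_exit_tree_rev:
  "\<gamma> \<noteq> [] \<Longrightarrow> first_entrance_tree \<gamma> = last_exit_tree (rev \<gamma>)"
proof (induction \<gamma> rule: rev_induct)
  case (snoc x \<gamma>)
  show ?case
  proof (cases "\<gamma> = []")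
    case True
    then show ?thesis by (simp add: first_entrance_tree_def)
  next
    case False
    then show ?thesis
      using snoc by (simp add: first_entrance_tree_snoc last_exit_tree_Cons hd_rev)
  qed
qed simp

section \<open>Weighted path sums: symmetry in the endpoints and comparison of the two trees\<close>

fun path_weight :: "('v \<Rightarrow> 'v \<Rightarrow> 'a::comm_semiring_1) \<Rightarrow> 'v list \<Rightarrow> 'a" where
  "path_weight k (x # y # \<gamma>) = k x y * path_weight k (y # \<gamma>)"
| "path_weight k _ = 1"

lemma path_weight_Cons: "\<gamma> \<noteq> [] \<Longrightarrow> path_weight k (x # \<gamma>) = k x (hd \<gamma>) * path_weight k \<gamma>"
  by (cases \<gamma>) auto

lemma path_weight_snoc: "\<gamma> \<noteq> [] \<Longrightarrow> path_weight k (\<gamma> @ [y]) = path_weight k \<gamma> * k (last \<gamma>) y"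
proof (induction \<gamma>)
  case (Cons x \<gamma>)
  then show ?case by (cases "\<gamma> = []") (auto simp: path_weight_Cons mult_ac)
qed simp

lemma path_weight_rev:
  assumes "\<And>x y. k x y = k y x"
  shows "path_weight k (rev \<gamma>) = path_weight k \<gamma>"
proof (induction \<gamma>)
  case (Cons x \<gamma>)
  then show ?case using assms[of x "hd \<gamma>"]
    by (cases "\<gamma> = []") (auto simp: path_weight_Cons path_weight_snoc last_rev mult_ac)
qed simp

text \<open>Only the edge set of the tree is recorded, since its vertex set is already
  \<open>set_mset \<mu>\<close>. \<open>T\<close> may be any set of vertex sets; if it is not such a
  tree, the set of paths is empty.\<close>

definition last_exit_paths :: "'v multiset \<Rightarrow> 'v \<Rightarrow> 'v \<Rightarrow> 'v set set \<Rightarrow> 'v list set" where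
  "last_exit_paths \<mu> x y T =
    {\<gamma>. mset \<gamma> = \<mu> \<and> \<gamma> \<noteq> [] \<and> hd \<gamma> = x \<and> last \<gamma> = y \<and> snd (last_exit_tree \<gamma>) = T}"

lemma finite_last_exit_paths [simp]: "finite (last_exit_paths \<mu> x y T)"
proof (rule finite_subset)
  show "last_exit_paths \<mu> x y T \<subseteq> {\<gamma>. set \<gamma> \<subseteq> set_mset \<mu> \<and> length \<gamma> = size \<mu>}"
    by (auto simp: last_exit_paths_def)
qed (simp add: finite_lists_length_eq)

lemma last_exit_paths_singleton:
  "last_exit_paths {#y#} u z T = (if u = y \<and> z = y \<and> T = {} then {[y]} else {})"
  by (auto simp: last_exit_paths_def)

text \<open>The paths are sorted by their second vertex \<open>u\<close>. If \<open>x\<close> recurs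
  in the tail, the tail has the same tree; otherwise \<open>{x, u}\<close> is a leaf edge, which
  must lie in \<open>T\<close> and is removed for the tail.\<close>

lemma last_exit_paths_step:
  assumes "x \<in># \<mu>" "\<mu> \<noteq> {#x#}"
  shows "last_exit_paths \<mu> x y T = (\<Union>u\<in>set_mset \<mu>. (#) x `
    (if x \<in># \<mu> - {#x#} then last_exit_paths (\<mu> - {#x#}) u y T
     else if {x, u} \<in> T then last_exit_paths (\<mu> - {#x#}) u y (T - {{x, u}}) else {}))"
    (is "?L = ?R")
proof (rule set_eqI)
  fix \<gamma>
  show "\<gamma> \<in> ?L \<longleftrightarrow> \<gamma> \<in> ?R"
  proof
    assume "\<gamma> \<in> ?L"
    then obtain \<delta> where \<gamma>: "\<gamma> = x # \<delta>" and \<mu>: "\<mu> = add_mset x (mset \<delta>)"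
      and l: "last (x # \<delta>) = y" and T: "snd (last_exit_tree (x # \<delta>)) = T"
      by (auto simp: last_exit_paths_def neq_Nil_conv)
    have ne: "\<delta> \<noteq> []" using assms \<mu> by auto
    have h: "hd \<delta> \<in># \<mu>" using ne \<mu> by simp
    show "\<gamma> \<in> ?R"
    proof (cases "x \<in> set \<delta>")
      case True
      then show ?thesis using \<gamma> \<mu> l T ne h
        by (auto simp: last_exit_paths_def last_exit_tree_Cons)
    next
      case False
      \<comment> \<open>Edges of the tree of the tail avoid \<open>x\<close>, so removing
        \<open>{x, hd \<delta>}\<close> from \<open>T\<close> leaves exactly that tree.\<close>
      then have "{x, hd \<delta>} \<notin> snd (last_exit_tree \<delta>)"
        using last_exit_tree_edges_subset[OF ne] by blast
      moreover have "T = insert {x, hd \<delta>} (snd (last_exit_tree \<delta>))"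
        using T ne False by (simp add: last_exit_tree_Cons)
      ultimately have "{x, hd \<delta>} \<in> T" "\<delta> \<in> last_exit_paths (mset \<delta>) (hd \<delta>) y (T - {{x, hd \<delta>}})"
        using ne l by (auto simp: last_exit_paths_def)
      then show ?thesis using \<gamma> \<mu> h False by (intro UN_I[of "hd \<delta>"]) auto
    qed
  next
    assume "\<gamma> \<in> ?R"
    then obtain u \<delta> where "\<gamma> = x # \<delta>"
      and "\<delta> \<in> (if x \<in># \<mu> - {#x#} then last_exit_paths (\<mu> - {#x#}) u y T
        else if {x, u} \<in> T then last_exit_paths (\<mu> - {#x#}) u y (T - {{x, u}}) else {})"
      by blast
    then show "\<gamma> \<in> ?L"
      using assms(1)
      by (auto simp: last_exit_paths_def last_exit_tree_Cons set_mset_mset[symmetric] insert_absorb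
            simp del: set_mset_mset split: if_splits)
  qed
qed

definition last_exit_sum ::
  "('v \<Rightarrow> 'v \<Rightarrow> 'a::comm_semiring_1) \<Rightarrow> 'v multiset \<Rightarrow> 'v \<Rightarrow> 'v \<Rightarrow> 'v set set \<Rightarrow> 'a" where
  "last_exit_sum k \<mu> x y T = sum (path_weight k) (last_exit_paths \<mu> x y T)"

text \<open>The union over \<open>u\<close> is disjoint because \<open>u\<close> is the head of the
  tail, and each first step factors out \<open>k x u\<close>. Vertices outside \<open>\<mu>\<close>
  contribute 0, so any finite superset may index the sum; two successive steps can thus share one
  index set.\<close>

lemma last_exit_sum_step:
  assumes "x \<in># \<mu>" "\<mu> \<noteq> {#x#}" "finite V" "set_mset \<mu> \<subseteq> V"
  shows "last_exit_sum k \<mu> x y T = (\<Sum>u\<in>V. k x u *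
    (if x \<in># \<mu> - {#x#} then last_exit_sum k (\<mu> - {#x#}) u y T
     else if {x, u} \<in> T then last_exit_sum k (\<mu> - {#x#}) u y (T - {{x, u}}) else 0))"
proof -
  define B where "B u = (if x \<in># \<mu> - {#x#} then last_exit_paths (\<mu> - {#x#}) u y T
     else if {x, u} \<in> T then last_exit_paths (\<mu> - {#x#}) u y (T - {{x, u}}) else {})" for u
  have B: "\<delta> \<noteq> [] \<and> hd \<delta> = u \<and> mset \<delta> = \<mu> - {#x#}" if "\<delta> \<in> B u" for \<delta> u
    using that by (auto simp: B_def last_exit_paths_def split: if_splits)
  have fin: "finite (B u)" for u by (simp add: B_def)
  have empty: "B u = {}" if "u \<notin> set_mset \<mu>" for u
  proof -
    have False if \<delta>: "\<delta> \<in> B u" for \<delta>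
    proof -
      have "u \<in> set \<delta>" using B[OF \<delta>] by auto
      then have "u \<in># \<mu> - {#x#}" using B[OF \<delta>] by (metis set_mset_mset)
      then show False using \<open>u \<notin> set_mset \<mu>\<close> by (auto dest: in_diffD)
    qed
    then show ?thesis by blast
  qed
  have "last_exit_paths \<mu> x y T = (\<Union>u\<in>V. (#) x ` B u)"
    unfolding last_exit_paths_step[OF assms(1,2)] B_def[symmetric]
    using empty assms(4) by blast
  then have "last_exit_sum k \<mu> x y T = (\<Sum>u\<in>V. sum (path_weight k) ((#) x ` B u))"
    unfolding last_exit_sum_def
    using fin assms(3) by (simp, intro sum.UNION_disjoint) (auto dest: B)
  also have "\<dots> = (\<Sum>u\<in>V. k x u * sum (path_weight k) (B u))"
  proof (rule sum.cong[OF refl])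
    fix u
    show "sum (path_weight k) ((#) x ` B u) = k x u * sum (path_weight k) (B u)"
      by (subst sum.reindex)
         (auto simp: sum_distrib_left path_weight_Cons dest: B intro!: sum.cong)
  qed
  finally show ?thesis
    by (auto simp: B_def last_exit_sum_def intro!: sum.cong)
qed

text \<open>Peeling off the first step at \<open>x\<close>, swapping the endpoints of the rest by induction, and
  peeling off the first step at \<open>y\<close> leaves an expression symmetric in \<open>(x, u)\<close> and \<open>(y, v)\<close>.\<close>

lemma last_exit_sum_commute:
  assumes sym: "\<And>x y. k x y = k y x"
  shows "last_exit_sum k \<mu> x y T = last_exit_sum k \<mu> y x T"
proof (induction "size \<mu>" arbitrary: \<mu> x y T rule: less_induct)
  case less
  let ?V = "set_mset \<mu>"
  have zero: "last_exit_sum k \<mu> a b T = 0" if "a \<notin># \<mu> \<or> b \<notin># \<mu>" for a b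
  proof -
    have "last_exit_paths \<mu> a b T = {}" using that by (auto simp: last_exit_paths_def)
    then show ?thesis by (simp add: last_exit_sum_def)
  qed
  \<comment> \<open>The two-vertex path is a case of its own: deleting one endpoint leaves a
    singleton multiset, to which the one-step decomposition does not apply.\<close>
  consider "x = y" | "x \<notin># \<mu> \<or> y \<notin># \<mu>" | "x \<noteq> y" "\<mu> = {#x, y#}"
    | "x \<noteq> y" "x \<in># \<mu>" "y \<in># \<mu>" "\<mu> \<noteq> {#x, y#}" by blast
  then show ?case
  proof cases
    case 1 then show ?thesis by simp
  next
    case 2 then show ?thesis using zero by metis
  next
    case 3
    have "last_exit_paths \<mu> a b T = (if T = {{a, b}} then {[a, b]} else {})"
      if "\<mu> = {#a, b#}" "a \<noteq> b" for a b
      using that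
      by (subst last_exit_paths_step) (auto simp: last_exit_paths_singleton doubleton_eq_iff)
    from this[of x y] this[of y x] show ?thesis
      using 3 sym[of x y] by (auto simp: last_exit_sum_def insert_commute add_mset_commute)
  next
    case 4
    let ?\<nu> = "\<mu> - {#x#} - {#y#}"
    \<comment> \<open>Three moves: peel off \<open>a\<close>, swap the endpoints of the shorter sum
      by the induction hypothesis, then peel off \<open>b\<close>.\<close>
    have two: "last_exit_sum k \<mu> a b T = (\<Sum>u\<in>?V. \<Sum>v\<in>?V. k a u * (k b v *
        (if a \<in># \<mu> - {#a#} then
           if b \<in># \<mu> - {#b#} then last_exit_sum k (\<mu> - {#a#} - {#b#}) v u T
           else if {b, v} \<in> T then last_exit_sum k (\<mu> - {#a#} - {#b#}) v u (T - {{b, v}}) else 0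
         else if {a, u} \<in> T then
           if b \<in># \<mu> - {#b#} then last_exit_sum k (\<mu> - {#a#} - {#b#}) v u (T - {{a, u}})
           else if {b, v} \<in> T - {{a, u}}
             then last_exit_sum k (\<mu> - {#a#} - {#b#}) v u (T - {{a, u}} - {{b, v}}) else 0
         else 0)))"
      if ab: "a \<noteq> b" "a \<in># \<mu>" "b \<in># \<mu>" "\<mu> \<noteq> {#a, b#}" for a b
    proof -
      have sz: "size (\<mu> - {#a#}) < size \<mu>" using ab by (simp add: size_Diff1_less)
      have b: "b \<in># \<mu> - {#a#}" using ab by (simp add: in_diff_count)
      have nb: "\<mu> - {#a#} \<noteq> {#b#}"
        using ab by (metis add_mset_commute insert_DiffM)
      \<comment> \<open>Since \<open>a \<noteq> b\<close>, deleting \<open>a\<close> does not affect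
        whether \<open>b\<close> recurs; so this condition does not depend on which endpoint is
        peeled first.\<close>
      have cnt: "b \<in># \<mu> - {#a#} - {#b#} \<longleftrightarrow> b \<in># \<mu> - {#b#}"
        using ab by (simp add: in_diff_count)
      have sub: "set_mset (\<mu> - {#a#}) \<subseteq> ?V" by (auto dest: in_diffD)
      have na: "\<mu> \<noteq> {#a#}" using ab by auto
      have inner: "last_exit_sum k (\<mu> - {#a#}) u b T' = (\<Sum>v\<in>?V. k b v *
          (if b \<in># \<mu> - {#b#} then last_exit_sum k (\<mu> - {#a#} - {#b#}) v u T'
           else if {b, v} \<in> T' then last_exit_sum k (\<mu> - {#a#} - {#b#}) v u (T' - {{b, v}}) else 0))"
        for u T'
        unfolding less[OF sz, of u b]
        using last_exit_sum_step[OF b nb finite_set_mset sub] cnt by simp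
      show ?thesis
        unfolding last_exit_sum_step[OF ab(2) na finite_set_mset order_refl]
        by (intro sum.cong refl, unfold inner) (simp add: sum_distrib_left)
    qed
    have "size ?\<nu> < size \<mu>"
      using 4 by (metis size_Diff1_le size_Diff1_less le_less_trans)
    note comm = less[OF this]
    have e: "\<mu> - {#y#} - {#x#} = ?\<nu>" by (simp add: diff_diff_add add_mset_commute)
    have ne: "\<mu> \<noteq> {#y, x#}" using 4 by (simp add: add_mset_commute)
    show ?thesis
      unfolding two[OF 4] two[OF 4(1)[symmetric] 4(3,2) ne] e
    \<comment> \<open>After exchanging the sums the summands agree one by one, up to swapping
      \<open>u\<close> and \<open>v\<close> in the remaining sum. If neither \<open>x\<close> nor
      \<open>y\<close> recurs, both sides require \<open>{x, v}\<close> and \<open>{y, u}\<close> to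
      be distinct elements of \<open>T\<close>.\<close>
    proof (subst sum.swap, intro sum.cong refl)
      fix u v
      show "k x v * (k y u *
        (if x \<in># \<mu> - {#x#} then
           if y \<in># \<mu> - {#y#} then last_exit_sum k ?\<nu> u v T
           else if {y, u} \<in> T then last_exit_sum k ?\<nu> u v (T - {{y, u}}) else 0
         else if {x, v} \<in> T then
           if y \<in># \<mu> - {#y#} then last_exit_sum k ?\<nu> u v (T - {{x, v}})
           else if {y, u} \<in> T - {{x, v}}
             then last_exit_sum k ?\<nu> u v (T - {{x, v}} - {{y, u}}) else 0
         else 0)) = k y u * (k x v *
        (if y \<in># \<mu> - {#y#} then
           if x \<in># \<mu> - {#x#} then last_exit_sum k ?\<nu> v u T
           else if {x, v} \<in> T then last_exit_sum k ?\<nu> v u (T - {{x, v}}) else 0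
         else if {y, u} \<in> T then
           if x \<in># \<mu> - {#x#} then last_exit_sum k ?\<nu> v u (T - {{y, u}})
           else if {x, v} \<in> T - {{y, u}}
             then last_exit_sum k ?\<nu> v u (T - {{y, u}} - {{x, v}}) else 0
         else 0))"
        unfolding comm[of u v]
        by (auto simp: mult_ac Diff_insert2[symmetric] insert_commute)
    qed
  qed
qed

text \<open>The coefficient \<open>c\<close> sees a path only through its multiset, endpoints and
  tree, so it is constant on classes of paths sharing these data. The first-entrance class from
  \<open>x\<close> to \<open>y\<close> consists of the reversals of the last-exit class from
  \<open>y\<close> to \<open>x\<close>; endpoint symmetry then equates the class weights. The bound
  \<open>N\<close> keeps the sums finite.\<close>

lemma sum_first_entrance_eq_sum_last_exit:
  fixes k :: "'v \<Rightarrow> 'v \<Rightarrow> 'a::comm_semiring_1"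
    and c :: "'v multiset \<Rightarrow> 'v \<Rightarrow> 'v \<Rightarrow> 'v set \<times> 'v set set \<Rightarrow> 'a"
    and V :: "'v set" and N :: nat
  assumes sym: "\<And>x y. k x y = k y x" and "finite V"
  defines "\<Gamma> \<equiv> {\<gamma>. set \<gamma> \<subseteq> V \<and> \<gamma> \<noteq> [] \<and> length \<gamma> \<le> N}"
  shows "(\<Sum>\<gamma>\<in>\<Gamma>. c (mset \<gamma>) (hd \<gamma>) (last \<gamma>) (first_entrance_tree \<gamma>) * path_weight k \<gamma>) =
    (\<Sum>\<gamma>\<in>\<Gamma>. c (mset \<gamma>) (hd \<gamma>) (last \<gamma>) (last_exit_tree \<gamma>) * path_weight k \<gamma>)"
    (is "?F = ?L")
proof -
  define kL where "kL \<gamma> = (mset \<gamma>, hd \<gamma>, last \<gamma>, snd (last_exit_tree \<gamma>))" for \<gamma> :: "'v list"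
  define kF where "kF \<gamma> = (mset \<gamma>, hd \<gamma>, last \<gamma>, snd (first_entrance_tree \<gamma>))" for \<gamma> :: "'v list"
  have fin: "finite \<Gamma>"
    unfolding \<Gamma>_def
    by (rule finite_subset[OF _ finite_lists_length_le[OF \<open>finite V\<close>, of N]]) auto
  \<comment> \<open>Taking the keys of both kinds lets both sums be grouped over one index set; some
    classes may be empty.\<close>
  define K where "K = kL ` \<Gamma> \<union> kF ` \<Gamma>"
  have finK: "finite K" using fin by (simp add: K_def)
  have "?F = (\<Sum>\<kappa>\<in>K. \<Sum>\<gamma>\<in>{\<gamma> \<in> \<Gamma>. kF \<gamma> = \<kappa>}.
      c (mset \<gamma>) (hd \<gamma>) (last \<gamma>) (first_entrance_tree \<gamma>) * path_weight k \<gamma>)"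
    by (rule sum.group[symmetric]) (auto simp: fin finK K_def)
  also have "\<dots> = (\<Sum>\<kappa>\<in>K. \<Sum>\<gamma>\<in>{\<gamma> \<in> \<Gamma>. kL \<gamma> = \<kappa>}.
      c (mset \<gamma>) (hd \<gamma>) (last \<gamma>) (last_exit_tree \<gamma>) * path_weight k \<gamma>)"
  proof (rule sum.cong[OF refl])
    fix \<kappa> assume "\<kappa> \<in> K"
    obtain \<mu> x y T where \<kappa>: "\<kappa> = (\<mu>, x, y, T)" by (cases \<kappa>) auto
    have \<mu>: "set_mset \<mu> \<subseteq> V" "size \<mu> \<le> N"
      using \<open>\<kappa> \<in> K\<close> by (auto simp: K_def kL_def kF_def \<Gamma>_def \<kappa>)
    have L: "{\<gamma> \<in> \<Gamma>. kL \<gamma> = \<kappa>} = last_exit_paths \<mu> x y T"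
      using \<mu> by (auto simp: \<Gamma>_def kL_def \<kappa> last_exit_paths_def)
    have F: "{\<gamma> \<in> \<Gamma>. kF \<gamma> = \<kappa>} = rev ` last_exit_paths \<mu> y x T"
    proof (intro set_eqI iffI)
      fix \<gamma> assume "\<gamma> \<in> {\<gamma> \<in> \<Gamma>. kF \<gamma> = \<kappa>}"
      then have "rev \<gamma> \<in> last_exit_paths \<mu> y x T"
        by (auto simp: \<Gamma>_def kF_def \<kappa> last_exit_paths_def hd_rev last_rev
            first_entrance_tree_eq_last_exit_tree_rev)
      then show "\<gamma> \<in> rev ` last_exit_paths \<mu> y x T" by (metis image_eqI rev_rev_ident)
    next
      fix \<gamma> assume "\<gamma> \<in> rev ` last_exit_paths \<mu> y x T"
      then show "\<gamma> \<in> {\<gamma> \<in> \<Gamma>. kF \<gamma> = \<kappa>}"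
        using \<mu> by (auto simp: \<Gamma>_def kF_def \<kappa> last_exit_paths_def hd_rev last_rev
            first_entrance_tree_eq_last_exit_tree_rev)
    qed
    have "(\<Sum>\<gamma>\<in>{\<gamma> \<in> \<Gamma>. kF \<gamma> = \<kappa>}.
        c (mset \<gamma>) (hd \<gamma>) (last \<gamma>) (first_entrance_tree \<gamma>) * path_weight k \<gamma>) =
      (\<Sum>\<gamma>\<in>{\<gamma> \<in> \<Gamma>. kF \<gamma> = \<kappa>}. c \<mu> x y (set_mset \<mu>, T) * path_weight k \<gamma>)"
    proof (rule sum.cong[OF refl])
      fix \<gamma> assume "\<gamma> \<in> {\<gamma> \<in> \<Gamma>. kF \<gamma> = \<kappa>}"
      then have "mset \<gamma> = \<mu>" "hd \<gamma> = x" "last \<gamma> = y" "first_entrance_tree \<gamma> = (set_mset \<mu>, T)"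
        by (auto simp: kF_def \<kappa> first_entrance_tree_def)
      then show "c (mset \<gamma>) (hd \<gamma>) (last \<gamma>) (first_entrance_tree \<gamma>) * path_weight k \<gamma> =
        c \<mu> x y (set_mset \<mu>, T) * path_weight k \<gamma>" by simp
    qed
    also have "\<dots> = c \<mu> x y (set_mset \<mu>, T) * last_exit_sum k \<mu> y x T"
      unfolding F last_exit_sum_def
      by (subst sum.reindex) (auto simp: inj_on_def sum_distrib_left path_weight_rev[of k, OF sym])
    also have "\<dots> = c \<mu> x y (set_mset \<mu>, T) * last_exit_sum k \<mu> x y T"
      by (simp only: last_exit_sum_commute[of k, OF sym, of \<mu> y x T])
    also have "\<dots> = (\<Sum>\<gamma>\<in>{\<gamma> \<in> \<Gamma>. kL \<gamma> = \<kappa>}. c \<mu> x y (set_mset \<mu>, T) * path_weight k \<gamma>)"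
      unfolding L last_exit_sum_def by (simp add: sum_distrib_left)
    also have "\<dots> = (\<Sum>\<gamma>\<in>{\<gamma> \<in> \<Gamma>. kL \<gamma> = \<kappa>}.
        c (mset \<gamma>) (hd \<gamma>) (last \<gamma>) (last_exit_tree \<gamma>) * path_weight k \<gamma>)"
    proof (rule sum.cong[OF refl])
      fix \<gamma> assume "\<gamma> \<in> {\<gamma> \<in> \<Gamma>. kL \<gamma> = \<kappa>}"
      then have "mset \<gamma> = \<mu>" "hd \<gamma> = x" "last \<gamma> = y" "last_exit_tree \<gamma> = (set_mset \<mu>, T)"
        by (auto simp: kL_def \<kappa> last_exit_tree_def)
      then show "c \<mu> x y (set_mset \<mu>, T) * path_weight k \<gamma> =
        c (mset \<gamma>) (hd \<gamma>) (last \<gamma>) (last_exit_tree \<gamma>) * path_weight k \<gamma>" by simp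
    qed
    finally show "(\<Sum>\<gamma>\<in>{\<gamma> \<in> \<Gamma>. kF \<gamma> = \<kappa>}.
        c (mset \<gamma>) (hd \<gamma>) (last \<gamma>) (first_entrance_tree \<gamma>) * path_weight k \<gamma>) =
      (\<Sum>\<gamma>\<in>{\<gamma> \<in> \<Gamma>. kL \<gamma> = \<kappa>}.
        c (mset \<gamma>) (hd \<gamma>) (last \<gamma>) (last_exit_tree \<gamma>) * path_weight k \<gamma>)" .
  qed
  also have "\<dots> = ?L"
    by (rule sum.group) (auto simp: fin finK K_def)
  finally show ?thesis .
qed

text \<open>The factors \<open>r y / r x\<close> telescope along the path.\<close>

lemma path_weight_rescale:
  fixes r :: "'v \<Rightarrow> 'a::field"
  assumes "\<And>x. r x \<noteq> 0" "\<gamma> \<noteq> []"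
  shows "path_weight (\<lambda>x y. k x y * r y / r x) \<gamma> = path_weight k \<gamma> * r (last \<gamma>) / r (hd \<gamma>)"
  using assms(2)
proof (induction \<gamma>)
  case (Cons x \<gamma>)
  then show ?case using assms(1) by (cases "\<gamma> = []") (auto simp: path_weight_Cons)
qed simp

section \<open>Initial segments, stopping at the cover time, and the symmetrized kernel\<close>

lemma path_upto_eq_iff:
  "path_upto X n \<omega> = \<gamma> \<longleftrightarrow> length \<gamma> = Suc n \<and> (\<forall>i\<le>n. X i \<omega> = \<gamma> ! i)"
  by (auto simp: path_upto_def list_eq_iff_nth_eq less_Suc_eq_le simp del: upt_Suc)

lemma length_path_upto [simp]: "length (path_upto X n \<omega>) = Suc n"
  by (simp add: path_upto_def)

lemma path_upto_not_Nil [simp]: "path_upto X n \<omega> \<noteq> []"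
  by (simp add: path_upto_def)

lemma set_path_upto: "set (path_upto X n \<omega>) = (\<lambda>i. X i \<omega>) ` {..n}"
  by (auto simp: path_upto_def less_Suc_eq_le simp del: upt_Suc)

lemma path_upto_Suc: "path_upto X (Suc n) \<omega> = path_upto X n \<omega> @ [X (Suc n) \<omega>]"
  by (simp add: path_upto_def)

text \<open>This replaces the extended-natural cover time by a finite index \<open>m\<close>: no
  earlier segment covers \<open>V\<close>, and the walk stops at \<open>m\<close> either by covering
  or by reaching \<open>n\<close>.\<close>

lemma path_upto_cover_cases:
  obtains m where "path_upto_cover V X n \<omega> = path_upto X m \<omega>" "m \<le> n"
    "\<forall>i<m. set (path_upto X i \<omega>) \<noteq> V" "m = n \<or> set (path_upto X m \<omega>) = V"
proof (cases "\<exists>i\<le>n. set (path_upto X i \<omega>) = V")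
  case True
  let ?m = "LEAST i. set (path_upto X i \<omega>) = V"
  have m: "set (path_upto X ?m \<omega>) = V" "?m \<le> n"
    using True by (metis (mono_tags, lifting) LeastI, metis (mono_tags, lifting) Least_le le_trans)
  have "cover_time V X \<omega> = enat ?m"
    unfolding cover_time_def set_path_upto[symmetric]
  proof (rule antisym)
    show "Inf (enat ` {n. set (path_upto X n \<omega>) = V}) \<le> enat ?m"
      by (rule Inf_lower) (use m in simp)
    show "enat ?m \<le> Inf (enat ` {n. set (path_upto X n \<omega>) = V})"
      by (rule Inf_greatest) (auto intro: Least_le)
  qed
  then have "path_upto_cover V X n \<omega> = path_upto X ?m \<omega>"
    using m(2) by (simp add: path_upto_cover_def min_def)
  then show thesis using that m not_less_Least by blast
next
  case False
  then have "n \<le> i" if "set (path_upto X i \<omega>) = V" for i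
    using that nat_le_linear by blast
  \<comment> \<open>This includes the value \<open>\<infinity>\<close> when \<open>V\<close> is
    never covered; the minimum with \<open>n\<close> is \<open>n\<close> in either case.\<close>
  then have "enat n \<le> cover_time V X \<omega>"
    unfolding cover_time_def set_path_upto[symmetric]
    by (intro Inf_greatest) auto
  then have "path_upto_cover V X n \<omega> = path_upto X n \<omega>"
    by (simp add: path_upto_cover_def min_def)
  then show thesis using that[of n] False by auto
qed

text \<open>Reversibility in conjugated form: with \<open>r\<close> the square root of the vertex
  weight, \<open>k x y = w {x, y} / (r x * r y)\<close> on edges is symmetric, and conjugating it by
  \<open>r\<close> gives the transition matrix.\<close>

lemma (in finite_connected_network) transition_prob_symmetrizable:
  obtains k :: "'v \<Rightarrow> 'v \<Rightarrow> real" and r :: "'v \<Rightarrow> real"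
  where "\<And>x y. k x y = k y x" "\<And>x. r x \<noteq> 0"
    "transition_prob E w = (\<lambda>x y. k x y * r y / r x)"
proof
  define W where "W = vertex_weight E w"
  \<comment> \<open>The weight vanishes only at points without incident edges; the default 1 keeps
    \<open>r\<close> nonzero there.\<close>
  define r where "r x = sqrt (if W x = 0 then 1 else W x)" for x
  define k where "k x y = (if {x, y} \<in> E then w {x, y} else 0) / (r x * r y)" for x y
  have "finite E"
    by (rule finite_subset[of _ "Pow V"]) (use edges finite_V in auto)
  then have Wpos: "W x > 0" if "e \<in> E" "x \<in> e" for x e
    unfolding W_def vertex_weight_def
    by (intro sum_pos2[of _ e]) (use that weight_pos in \<open>auto intro: less_imp_le\<close>)
  show "k x y = k y x" for x y by (simp add: k_def insert_commute mult.commute)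
  show r: "r x \<noteq> 0" for x by (simp add: r_def)
  show "transition_prob E w = (\<lambda>x y. k x y * r y / r x)"
  proof (intro ext)
    fix x y
    show "transition_prob E w x y = k x y * r y / r x"
    proof (cases "{x, y} \<in> E")
      case True
      then have "W x > 0" using Wpos by blast
      then have "r x * r x = W x" by (simp add: r_def)
      then show ?thesis using True r[of y]
        by (simp add: transition_prob_def k_def W_def)
    qed (simp add: transition_prob_def k_def)
  qed
qed

section \<open>Laws of the two trees along the walk\<close>

context network_random_walk
begin

lemma X_in_V: "\<omega> \<in> space M \<Longrightarrow> X i \<omega> \<in> V"
  using random_variable_X[of i] by (auto simp: measurable_def)

lemma sets_X_eq [measurable]: "{\<omega> \<in> space M. X i \<omega> = x} \<in> events"
proof (cases "x \<in> V")
  case True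
  then have "X i -` {x} \<inter> space M \<in> events"
    using random_variable_X[of i] by (intro measurable_sets) auto
  also have "X i -` {x} \<inter> space M = {\<omega> \<in> space M. X i \<omega> = x}" by auto
  finally show ?thesis .
next
  case False
  then have "{\<omega> \<in> space M. X i \<omega> = x} = {}" using X_in_V by auto
  then show ?thesis by (simp only: sets.empty_sets)
qed

lemma sets_path_upto_eq [measurable]: "{\<omega> \<in> space M. path_upto X n \<omega> = \<gamma>} \<in> events"
  unfolding path_upto_eq_iff by measurable

lemma prob_path_upto:
  assumes "\<gamma> \<noteq> []" "set \<gamma> \<subseteq> V"
  shows "\<P>(\<omega> in M. path_upto X (length \<gamma> - 1) \<omega> = \<gamma>) =
    \<P>(\<omega> in M. X 0 \<omega> = hd \<gamma>) * path_weight (transition_prob E w) \<gamma>"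
  using assms
proof (induction \<gamma> rule: rev_induct)
  case (snoc y \<gamma>)
  show ?case
  proof (cases "\<gamma> = []")
    case True
    then show ?thesis by (simp add: path_upto_def)
  next
    case False
    then obtain m where m: "length \<gamma> = Suc m" by (cases \<gamma>) auto
    let ?A = "\<lambda>\<omega>. \<forall>i\<le>m. X i \<omega> = \<gamma> ! i"
    have IH: "\<P>(\<omega> in M. ?A \<omega>) =
        \<P>(\<omega> in M. X 0 \<omega> = hd \<gamma>) * path_weight (transition_prob E w) \<gamma>"
      using snoc False by (simp add: path_upto_eq_iff m)
    have ev: "(path_upto X (length (\<gamma> @ [y]) - 1) \<omega> = \<gamma> @ [y]) \<longleftrightarrow> X (Suc m) \<omega> = y \<and> ?A \<omega>" for \<omega>
      by (auto simp: path_upto_Suc m path_upto_eq_iff)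
    have step: "\<P>(\<omega> in M. X (Suc m) \<omega> = y \<and> ?A \<omega>) = \<P>(\<omega> in M. ?A \<omega>) * transition_prob E w (last \<gamma>) y"
    proof (cases "\<P>(\<omega> in M. ?A \<omega>) > 0")
      case True
      have "\<P>(\<omega> in M. X (Suc m) \<omega> = y \<bar> ?A \<omega>) = transition_prob E w (\<gamma> ! m) y"
        using snoc.prems m by (intro markov True) (auto simp: subset_iff)
      then show ?thesis using True False m
        by (simp add: cond_prob_def last_conv_nth field_simps)
    next
      \<comment> \<open>The Markov property says nothing about null histories, but then both sides
        are 0.\<close>
      case zero: False
      have "\<P>(\<omega> in M. X (Suc m) \<omega> = y \<and> ?A \<omega>) \<le> \<P>(\<omega> in M. ?A \<omega>)"
        by (intro finite_measure_mono) auto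
      then show ?thesis using zero
        by (simp add: not_less measure_le_0_iff)
    qed
    show ?thesis unfolding ev step IH
      using False by (simp add: path_weight_snoc)
  qed
qed simp

text \<open>Common frame for the fixed time and the stopped walk. By \<open>path\<close>, the event
  that \<open>Y\<close> equals an admissible list is that the walk starts with this list, so its
  probability is a product over steps. Admissibility depends only on multiset and endpoints, hence
  can be absorbed into the coefficient of the combinatorial identity.\<close>

lemma distr_first_entrance_tree_eq_last_exit_tree:
  fixes Q :: "'v multiset \<Rightarrow> 'v \<Rightarrow> 'v \<Rightarrow> bool" and N :: nat
  defines "\<Gamma> \<equiv> {\<gamma>. set \<gamma> \<subseteq> V \<and> \<gamma> \<noteq> [] \<and> length \<gamma> \<le> N \<and> Q (mset \<gamma>) (hd \<gamma>) (last \<gamma>)}"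
  assumes Y: "\<And>\<omega>. \<omega> \<in> space M \<Longrightarrow> Y \<omega> \<in> \<Gamma>"
    and path: "\<And>\<omega> \<gamma>. \<omega> \<in> space M \<Longrightarrow> \<gamma> \<in> \<Gamma> \<Longrightarrow> Y \<omega> = \<gamma> \<longleftrightarrow> path_upto X (length \<gamma> - 1) \<omega> = \<gamma>"
  shows "distr M (count_space UNIV) (\<lambda>\<omega>. first_entrance_tree (Y \<omega>)) =
    distr M (count_space UNIV) (\<lambda>\<omega>. last_exit_tree (Y \<omega>))"
proof -
  define \<Gamma>\<^sub>0 where "\<Gamma>\<^sub>0 = {\<gamma>. set \<gamma> \<subseteq> V \<and> \<gamma> \<noteq> [] \<and> length \<gamma> \<le> N}"
  have fin0: "finite \<Gamma>\<^sub>0"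
    unfolding \<Gamma>\<^sub>0_def by (rule finite_subset[OF _ finite_lists_length_le[OF finite_V, of N]]) auto
  have sub: "\<Gamma> \<subseteq> \<Gamma>\<^sub>0" by (auto simp: \<Gamma>_def \<Gamma>\<^sub>0_def)
  have fin: "finite \<Gamma>" using finite_subset[OF sub fin0] .
  have ev: "{\<omega> \<in> space M. Y \<omega> = \<gamma>} = {\<omega> \<in> space M. path_upto X (length \<gamma> - 1) \<omega> = \<gamma>}"
    if "\<gamma> \<in> \<Gamma>" for \<gamma> using path that by blast
  have Ymeas: "Y \<in> M \<rightarrow>\<^sub>M count_space \<Gamma>"
  proof -
    have "Y -` {\<gamma>} \<inter> space M \<in> events" if "\<gamma> \<in> \<Gamma>" for \<gamma>
    proof -
      have "Y -` {\<gamma>} \<inter> space M = {\<omega> \<in> space M. Y \<omega> = \<gamma>}" by auto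
      also have "\<dots> \<in> events" unfolding ev[OF that] by measurable
      finally show ?thesis .
    qed
    then show ?thesis using Y by (subst measurable_count_space_eq2[OF fin]) auto
  qed
  obtain k r where k: "\<And>x y. k x y = k y x" and r: "\<And>x::'v. r x \<noteq> (0::real)"
    and p: "transition_prob E w = (\<lambda>x y. k x y * r y / r x)"
    using transition_prob_symmetrizable by blast
  \<comment> \<open>The coefficient gathers the initial probability, the endpoint ratio left by
    telescoping, and the indicators of \<open>Q\<close> and of the tree lying in
    \<open>A\<close>.\<close>
  define c where "c A \<mu> x y t =
    (if Q \<mu> x y \<and> t \<in> A then \<P>(\<omega> in M. X 0 \<omega> = x) * r y / r x else 0)"
    for A :: "('v set \<times> 'v set set) set" and \<mu> x y t
  have em: "emeasure (distr M (count_space UNIV) (\<lambda>\<omega>. f (Y \<omega>))) A =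
    ennreal (\<Sum>\<gamma>\<in>\<Gamma>\<^sub>0. c A (mset \<gamma>) (hd \<gamma>) (last \<gamma>) (f \<gamma>) * path_weight k \<gamma>)"
    for f :: "'v list \<Rightarrow> 'v set \<times> 'v set set" and A
  proof -
    let ?B = "{\<gamma> \<in> \<Gamma>. f \<gamma> \<in> A}"
    have fm: "f \<in> count_space \<Gamma> \<rightarrow>\<^sub>M count_space UNIV" by simp
    have "distr M (count_space UNIV) (\<lambda>\<omega>. f (Y \<omega>)) =
        distr (distr M (count_space \<Gamma>) Y) (count_space UNIV) f"
      by (subst distr_distr[OF fm Ymeas]) (simp add: comp_def)
    then have "emeasure (distr M (count_space UNIV) (\<lambda>\<omega>. f (Y \<omega>))) A =
        emeasure (distr M (count_space \<Gamma>) Y) ?B"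
      by (simp add: emeasure_distr vimage_def Int_def conj_commute)
    also have "\<dots> = (\<Sum>\<gamma>\<in>?B. emeasure (distr M (count_space \<Gamma>) Y) {\<gamma>})"
      by (rule emeasure_eq_sum_singleton) (auto simp: fin)
    also have "\<dots> = (\<Sum>\<gamma>\<in>?B. ennreal (\<P>(\<omega> in M. X 0 \<omega> = hd \<gamma>) * path_weight (transition_prob E w) \<gamma>))"
    proof (rule sum.cong[OF refl])
      fix \<gamma> assume "\<gamma> \<in> ?B"
      then have g: "\<gamma> \<in> \<Gamma>" "\<gamma> \<noteq> []" "set \<gamma> \<subseteq> V" by (auto simp: \<Gamma>_def)
      have "emeasure (distr M (count_space \<Gamma>) Y) {\<gamma>} = emeasure M {\<omega> \<in> space M. Y \<omega> = \<gamma>}"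
        using g by (subst emeasure_distr[OF Ymeas]) (auto intro!: arg_cong[where f = "emeasure M"])
      then show "emeasure (distr M (count_space \<Gamma>) Y) {\<gamma>} =
          ennreal (\<P>(\<omega> in M. X 0 \<omega> = hd \<gamma>) * path_weight (transition_prob E w) \<gamma>)"
        unfolding ev[OF g(1)] emeasure_eq_measure prob_path_upto[OF g(2,3)] .
    qed
    also have "\<dots> = ennreal (\<Sum>\<gamma>\<in>?B. \<P>(\<omega> in M. X 0 \<omega> = hd \<gamma>) * path_weight (transition_prob E w) \<gamma>)"
    proof (rule sum_ennreal)
      fix \<gamma> assume "\<gamma> \<in> ?B"
      then have "\<gamma> \<noteq> []" "set \<gamma> \<subseteq> V" by (auto simp: \<Gamma>_def)
      from prob_path_upto[OF this]
      show "0 \<le> \<P>(\<omega> in M. X 0 \<omega> = hd \<gamma>) * path_weight (transition_prob E w) \<gamma>"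
        by (metis measure_nonneg)
    qed
    \<comment> \<open>As \<open>c\<close> vanishes on the added lists, the sum extends from
      \<open>?B\<close> to all of \<open>\<Gamma>\<^sub>0\<close>, the range of the combinatorial
      identity.\<close>
    also have "(\<Sum>\<gamma>\<in>?B. \<P>(\<omega> in M. X 0 \<omega> = hd \<gamma>) * path_weight (transition_prob E w) \<gamma>) =
        (\<Sum>\<gamma>\<in>\<Gamma>\<^sub>0. c A (mset \<gamma>) (hd \<gamma>) (last \<gamma>) (f \<gamma>) * path_weight k \<gamma>)"
      using sub
      by (intro sum.mono_neutral_cong_left fin0)
         (auto simp: \<Gamma>_def \<Gamma>\<^sub>0_def c_def p path_weight_rescale[of r, OF r])
    finally show ?thesis .
  qed
  show ?thesis
  proof (rule measure_eqI)
    fix A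
    show "emeasure (distr M (count_space UNIV) (\<lambda>\<omega>. first_entrance_tree (Y \<omega>))) A =
      emeasure (distr M (count_space UNIV) (\<lambda>\<omega>. last_exit_tree (Y \<omega>))) A"
      unfolding em \<Gamma>\<^sub>0_def
      using sum_first_entrance_eq_sum_last_exit[of k, OF k finite_V, of "c A" N] by simp
  qed simp
qed

lemma distr_trees_path_upto:
  "distr M (count_space UNIV) (\<lambda>\<omega>. first_entrance_tree (path_upto X n \<omega>)) =
    distr M (count_space UNIV) (\<lambda>\<omega>. last_exit_tree (path_upto X n \<omega>))"
proof (rule distr_first_entrance_tree_eq_last_exit_tree[where N = "Suc n"
      and Q = "\<lambda>\<mu> x y. size \<mu> = Suc n"])
  show "path_upto X n \<omega> \<in> {\<gamma>. set \<gamma> \<subseteq> V \<and> \<gamma> \<noteq> [] \<and> length \<gamma> \<le> Suc n \<and> size (mset \<gamma>) = Suc n}"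
    if "\<omega> \<in> space M" for \<omega>
    using X_in_V[OF that] by (auto simp: set_path_upto)
qed auto

text \<open>Whether a list occurs as a walk stopped at the cover time depends only on its endpoints and
  vertex multiplicities: it covers \<open>V\<close> for the first time at its end iff its last vertex occurs in
  it only once.\<close>

lemma distr_trees_path_upto_cover:
  "distr M (count_space UNIV) (\<lambda>\<omega>. first_entrance_tree (path_upto_cover V X n \<omega>)) =
    distr M (count_space UNIV) (\<lambda>\<omega>. last_exit_tree (path_upto_cover V X n \<omega>))"
proof -
  \<comment> \<open>A stopped path either covers \<open>V\<close>, and then its last vertex must be
    new, or it does not, and then it must have run the full \<open>n\<close> steps, that is, have
    \<open>n + 1\<close> vertices.\<close>
  define Q where "Q \<mu> x y \<longleftrightarrow>
    (if set_mset \<mu> = V then count \<mu> y = 1 else size \<mu> = Suc n)" for \<mu> and x y :: 'v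
  let ?\<Gamma> = "{\<gamma>. set \<gamma> \<subseteq> V \<and> \<gamma> \<noteq> [] \<and> length \<gamma> \<le> Suc n \<and> Q (mset \<gamma>) (hd \<gamma>) (last \<gamma>)}"
  have inV: "set (path_upto X i \<omega>) \<subseteq> V" if "\<omega> \<in> space M" for i \<omega>
    using X_in_V[OF that] by (auto simp: set_path_upto)
  have mono: "set (path_upto X i \<omega>) \<subseteq> set (path_upto X j \<omega>)" if "i \<le> j" for i j \<omega>
    using that by (auto simp: set_path_upto)
  have first: "count (mset (path_upto X j \<omega>)) (last (path_upto X j \<omega>)) = 1 \<longleftrightarrow>
      (\<forall>i<j. set (path_upto X i \<omega>) \<noteq> V)"
    if \<omega>: "\<omega> \<in> space M" and cov: "set (path_upto X j \<omega>) = V" for j \<omega>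
  proof (cases j)
    case 0
    then show ?thesis by (simp add: path_upto_def)
  next
    case (Suc m)
    have "count (mset (path_upto X j \<omega>)) (last (path_upto X j \<omega>)) = 1 \<longleftrightarrow>
        X (Suc m) \<omega> \<notin> set (path_upto X m \<omega>)"
      by (simp add: Suc path_upto_Suc count_mset_0_iff)
    also have "\<dots> \<longleftrightarrow> set (path_upto X m \<omega>) \<noteq> V"
      using cov X_in_V[OF \<omega>] by (auto simp: Suc path_upto_Suc)
    \<comment> \<open>Visited sets increase with time, so it suffices to test the segment just
      before \<open>j\<close>.\<close>
    also have "\<dots> \<longleftrightarrow> (\<forall>i<j. set (path_upto X i \<omega>) \<noteq> V)"
      using mono[of _ m \<omega>] inV[OF \<omega>, of m] Suc by (auto simp: less_Suc_eq_le)
    finally show ?thesis .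
  qed
  show ?thesis
  proof (rule distr_first_entrance_tree_eq_last_exit_tree[where N = "Suc n" and Q = Q])
    fix \<omega> assume \<omega>: "\<omega> \<in> space M"
    obtain m where m: "path_upto_cover V X n \<omega> = path_upto X m \<omega>" "m \<le> n"
      "\<forall>i<m. set (path_upto X i \<omega>) \<noteq> V" "m = n \<or> set (path_upto X m \<omega>) = V"
      using path_upto_cover_cases[of V X n \<omega>] by blast
    show "path_upto_cover V X n \<omega> \<in> ?\<Gamma>"
      using m inV[OF \<omega>, of m] first[OF \<omega>, of m] by (auto simp: Q_def)
    fix \<gamma> assume \<gamma>: "\<gamma> \<in> ?\<Gamma>"
    show "path_upto_cover V X n \<omega> = \<gamma> \<longleftrightarrow> path_upto X (length \<gamma> - 1) \<omega> = \<gamma>"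
    proof
      assume "path_upto_cover V X n \<omega> = \<gamma>"
      then show "path_upto X (length \<gamma> - 1) \<omega> = \<gamma>" using m(1) by auto
    next
      define j where "j = length \<gamma> - 1"
      assume "path_upto X (length \<gamma> - 1) \<omega> = \<gamma>"
      then have g: "\<gamma> = path_upto X j \<omega>" by (simp add: j_def)
      have jn: "j \<le> n" using \<gamma> by (auto simp: j_def)
      \<comment> \<open>If the segment up to \<open>j\<close> covers \<open>V\<close>, it does so
        for the first time, so the walk stops there. If not, \<open>j = n\<close>, and by
        monotonicity no segment up to \<open>n\<close> covers \<open>V\<close>, so the walk stops at
        \<open>n\<close>.\<close>
      have "m = j"
      proof (cases "set (path_upto X j \<omega>) = V")
        case True
        then have "\<forall>i<j. set (path_upto X i \<omega>) \<noteq> V"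
          using \<gamma> first[OF \<omega> True] by (auto simp: g Q_def)
        then show ?thesis using m(3,4) True jn m(2) by (metis le_neq_implies_less linorder_neqE_nat not_less)
      next
        case False
        then have "j = n" using \<gamma> by (auto simp: g Q_def)
        then show ?thesis using False m(2,4) mono[of m n \<omega>] inV[OF \<omega>, of n] by auto
      qed
      then show "path_upto_cover V X n \<omega> = \<gamma>" using m(1) g by simp
    qed
  qed
qed

end

theorem corollary2p2:
  fixes V :: "'v set" and E :: "'v set set" and w :: "'v set \<Rightarrow> real"
    and M :: "'m measure" and X :: "nat \<Rightarrow> 'm \<Rightarrow> 'v" and n :: nat
  assumes "network_random_walk V E w M X"
  shows "distr M (count_space UNIV) (\<lambda>\<omega>. first_entrance_tree (path_upto X n \<omega>)) =
         distr M (count_space UNIV) (\<lambda>\<omega>. last_exit_tree (path_upto X n \<omega>)) \<and>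
         distr M (count_space UNIV) (\<lambda>\<omega>. first_entrance_tree (path_upto_cover V X n \<omega>)) =
         distr M (count_space UNIV) (\<lambda>\<omega>. last_exit_tree (path_upto_cover V X n \<omega>))"
proof -
  interpret network_random_walk V E w M X by (rule assms)
  show ?thesis using distr_trees_path_upto distr_trees_path_upto_cover by blast
qed

end
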